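(* For each even positive integer $n$ and each positive odd integer $k<n^2/2+1$ there is a Seidel matrix of a tournament of order $n+2$ whose determinant is $k^2$.
   Context: A tournament of order $m$ is a digraph on $\{1,\dots,m\}$ with exactly one of the arcs $ij$, $ji$ for each pair $i\ne j$. Its Seidel matrix $S=[s_{ij}]$ is the $m\times m$ skew-symmetric matrix with zero diagonal, $s_{ij}=1$ if $ij$ is an arc and $s_{ij}=-1$ otherwise. *)

theory Defs
  imports "Jordan_Normal_Form.Determinant" "Graph_Theory.Pair_Digraph"
begin

locale tournament = pair_digraph T for m :: nat and T :: "nat pair_pre_digraph" +
  assumes verts_eq: "pverts T = {1..m}"
    and one_arc: "\<And>i j. i \<in> {1..m} \<Longrightarrow> j \<in> {1..m} \<Longrightarrow> i \<noteq> j \<Longrightarrow>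
      ((i, j) \<in> parcs T) \<noteq> ((j, i) \<in> parcs T)"

text \<open>Matrix rows and columns are numbered from 0 and vertices from 1, hence the shift by
  \<open>Suc\<close>.\<close>

definition seidel_matrix :: "nat \<Rightarrow> nat pair_pre_digraph \<Rightarrow> int mat" where
  "seidel_matrix m T = mat m m (\<lambda>(i, j).
     if i = j then 0 else if (Suc i, Suc j) \<in> parcs T then 1 else -1)"

end

theory Submission
  imports Defs
begin

text \<open>
  The tournament consists of a transitive one on \<open>n\<close> vertices, with Seidel matrix \<open>A\<close>, and two more
  vertices joined to it by the columns \<open>(-1) ^ i\<close> and \<open>(-1) ^ i * y i\<close> with signs \<open>y i\<close>. Since
  \<open>det A = 1\<close> and \<open>inverse A\<close> has the entries \<open>(-1) ^ (i + j) * sgn (j - i)\<close>, the Schur complement of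
  \<open>A\<close> is a skew-symmetric 2-by-2 matrix, with off-diagonal entry \<open>1 - q\<close> for
  \<open>q = (\<Sum>i<n. y i * (n - 1 - 2 * i))\<close>. Pairing \<open>i\<close> with \<open>n - 1 - i\<close> shows that \<open>q / 2\<close> runs over the
  signed subset sums of \<open>1, 3, \<dots>, n - 1\<close>, that is, over all integers of absolute value at most
  \<open>n\<^sup>2 / 4\<close>.
\<close>

section \<open>Seidel matrices from sign functions, and Schur complements\<close>

lemma tournament_of_skew_signs:
  fixes s :: "nat \<Rightarrow> nat \<Rightarrow> int"
  assumes sign: "\<And>i j. i < m \<Longrightarrow> j < m \<Longrightarrow> i \<noteq> j \<Longrightarrow> s i j \<in> {1, -1}"
    and skew: "\<And>i j. i < m \<Longrightarrow> j < m \<Longrightarrow> s j i = - s i j"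
  obtains T where "tournament m T" and "seidel_matrix m T = mat m m (\<lambda>(i, j). s i j)"
proof -
  define T where "T = \<lparr>pverts = {1..m},
    parcs = {(i, j). i \<in> {1..m} \<and> j \<in> {1..m} \<and> s (i - 1) (j - 1) = 1}\<rparr>"
  have diag: "s i i = 0" if "i < m" for i
    using skew[OF that that] by simp
  have "tournament m T"
  proof
    show "finite (parcs T)"
      by (rule finite_subset[of _ "{1..m} \<times> {1..m}"]) (auto simp: T_def)
    fix i j assume ij: "i \<in> {1..m}" "j \<in> {1..m}" "i \<noteq> j"
    then have "s (i - 1) (j - 1) \<in> {1, -1}" "s (j - 1) (i - 1) = - s (i - 1) (j - 1)"
      by (intro sign skew; force)+
    with ij show "((i, j) \<in> parcs T) \<noteq> ((j, i) \<in> parcs T)"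
      by (auto simp: T_def)
  qed (use diag in \<open>auto simp: T_def\<close>)
  moreover have "s i j = -1" if "i < m" "j < m" "i \<noteq> j" "s i j \<noteq> 1" for i j
    using sign that by blast
  then have "seidel_matrix m T = mat m m (\<lambda>(i, j). s i j)"
    by (intro eq_matI) (auto simp: seidel_matrix_def T_def diag)
  ultimately show thesis
    by (rule that)
qed

text \<open>Column elimination: right multiplication by the unipotent \<open>?P\<close> clears the
  upper right block. Writing that block as \<open>A * X\<close> makes \<open>X\<close> play the role
  of the inverse of \<open>A\<close> applied to it, without inverting a matrix over a
  domain.\<close>

lemma det_four_block_mat_schur:
  fixes A :: "'a :: idom mat"
  assumes A: "A \<in> carrier_mat n n" and C: "C \<in> carrier_mat m n"
    and D: "D \<in> carrier_mat m m" and X: "X \<in> carrier_mat n m"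
  shows "det (four_block_mat A (A * X) C D) = det A * det (D - C * X)"
proof -
  let ?P = "four_block_mat (1\<^sub>m n) (- X) (0\<^sub>m m n) (1\<^sub>m m)"
  have "four_block_mat A (A * X) C D * ?P
      = four_block_mat (A * 1\<^sub>m n + A * X * 0\<^sub>m m n) (A * (- X) + A * X * 1\<^sub>m m)
          (C * 1\<^sub>m n + D * 0\<^sub>m m n) (C * (- X) + D * 1\<^sub>m m)"
    using assms by (intro mult_four_block_mat) auto
  also have "A * (- X) + A * X * 1\<^sub>m m = 0\<^sub>m n m"
    using A X by (intro eq_matI) auto
  also have "C * (- X) + D * 1\<^sub>m m = D - C * X"
    using C D X by (intro eq_matI) auto
  also have "A * 1\<^sub>m n + A * X * 0\<^sub>m m n = A"
    using A X by simp
  also have "C * 1\<^sub>m n + D * 0\<^sub>m m n = C"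
    using C D by simp
  finally have *: "four_block_mat A (A * X) C D * ?P
      = four_block_mat A (0\<^sub>m n m) C (D - C * X)" .
  have "det ?P = 1"
    using X by (subst det_four_block_mat_lower_left_zero[of _ n _ m]) auto
  then have "det (four_block_mat A (A * X) C D) = det (four_block_mat A (A * X) C D * ?P)"
    using assms by (subst det_mult[of _ "n + m"]) auto
  also have "\<dots> = det A * det (D - C * X)"
    unfolding * using assms by (subst det_four_block_mat_upper_right_zero[of _ n _ m]) auto
  finally show ?thesis .
qed

section \<open>The transitive tournament, its determinant and its inverse\<close>

definition transitive_sign :: "nat \<Rightarrow> nat \<Rightarrow> int" where
  "transitive_sign i j = (if i < j then 1 else if j < i then -1 else 0)"

definition transitive_mat :: "nat \<Rightarrow> int mat" where
  "transitive_mat n = mat n n (\<lambda>(i, j). transitive_sign i j)"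

lemma transitive_mat_carrier [simp]: "transitive_mat n \<in> carrier_mat n n"
  by (simp add: transitive_mat_def)

text \<open>The right-hand side is the sum after \<open>i\<close> minus the sum before
  \<open>i\<close>, expressed by initial segments so that later sums telescope.\<close>

lemma sum_transitive_sign:
  assumes "i < n"
  shows "(\<Sum>j<n. transitive_sign i j * x j) = (\<Sum>j<n. x j) - (\<Sum>j<i. x j) - (\<Sum>j<Suc i. x j)"
proof -
  have split: "(\<Sum>j<n. f j) = (\<Sum>j<Suc i. f j) + (\<Sum>j=Suc i..<n. f j)" for f :: "nat \<Rightarrow> int"
    using sum.atLeastLessThan_concat[of 0 "Suc i" n f] assms by (simp add: atLeast0LessThan)
  have "(\<Sum>j<n. transitive_sign i j * x j)
      = (\<Sum>j<Suc i. transitive_sign i j * x j) + (\<Sum>j=Suc i..<n. transitive_sign i j * x j)"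
    by (rule split)
  also have "(\<Sum>j<Suc i. transitive_sign i j * x j) = - (\<Sum>j<i. x j)"
    by (simp add: transitive_sign_def flip: sum_negf)
  also have "(\<Sum>j=Suc i..<n. transitive_sign i j * x j) = (\<Sum>j=Suc i..<n. x j)"
    by (intro sum.cong) (auto simp: transitive_sign_def)
  finally show ?thesis
    by (simp add: split[of x])
qed

lemma det_skew_2:
  fixes a :: "'a :: comm_ring_1"
  shows "det (mat 2 2 (\<lambda>(i, j). if i = j then 0 else if i < j then a else - a)) = a\<^sup>2"
proof -
  let ?M = "mat 2 2 (\<lambda>(i, j). if i = j then 0 else if i < j then a else - a)"
  have "det ?M = (\<Sum>j<2. ?M $$ (0, j) * cofactor ?M 0 j)"
    by (rule laplace_expansion_row) auto
  also have "\<dots> = a * cofactor ?M 0 1"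
    by (simp add: numeral_2_eq_2)
  also have "cofactor ?M 0 1 = a"
    by (simp add: cofactor_def mat_delete_def det_single)
  finally show ?thesis
    by (simp add: power2_eq_square)
qed

lemma det_transitive_mat:
  assumes "even n"
  shows "det (transitive_mat n) = 1"
proof -
  have "det (transitive_mat (2 * h)) = 1" for h
  proof (induction h)
    case 0
    show ?case by (simp add: transitive_mat_def)
  next
    case (Suc h)
    \<comment> \<open>Two vertices are split off at the front. The columns \<open>(-1, 1)\<close> of
      \<open>X\<close> are mapped by \<open>transitive_mat 2\<close> to the all-ones block, and the
      constant rows of \<open>C\<close> annihilate them, so the Schur complement is the smaller
      transitive matrix itself.\<close>
    define X :: "int mat" where "X = mat 2 (2 * h) (\<lambda>(i, j). if i = 0 then -1 else 1)"
    define C :: "int mat" where "C = mat (2 * h) 2 (\<lambda>_. -1)"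
    have "transitive_mat (2 * Suc h)
        = four_block_mat (transitive_mat 2) (transitive_mat 2 * X) C (transitive_mat (2 * h))"
      by (intro eq_matI)
        (auto simp: transitive_mat_def transitive_sign_def X_def C_def scalar_prod_def
          numeral_2_eq_2)
    then have "det (transitive_mat (2 * Suc h))
        = det (transitive_mat 2) * det (transitive_mat (2 * h) - C * X)"
      by (simp add: det_four_block_mat_schur[of _ 2 _ "2 * h"] C_def X_def)
    also have "transitive_mat 2
        = mat 2 2 (\<lambda>(i, j). if i = j then 0 else if i < j then 1 else - 1)"
      by (intro eq_matI) (auto simp: transitive_mat_def transitive_sign_def)
    also have "transitive_mat (2 * h) - C * X = transitive_mat (2 * h)"
      by (intro eq_matI)
        (auto simp: transitive_mat_def X_def C_def scalar_prod_def numeral_2_eq_2)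
    finally show ?case
      using Suc.IH det_skew_2[of "1 :: int"] by simp
  qed
  with assms show ?thesis
    by (auto elim: evenE)
qed

text \<open>For even \<open>n\<close> this is the inverse of \<open>transitive_mat n\<close> applied
  to the vector with entries \<open>(-1) ^ i * y i\<close>.\<close>

definition transitive_preimage :: "nat \<Rightarrow> (nat \<Rightarrow> int) \<Rightarrow> nat \<Rightarrow> int" where
  "transitive_preimage n y i = (-1) ^ i * ((\<Sum>j<n. y j) - (\<Sum>j<i. y j) - (\<Sum>j<Suc i. y j))"

lemma transitive_sign_preimage:
  assumes "even n" "i < n"
  shows "(\<Sum>j<n. transitive_sign i j * transitive_preimage n y j) = (-1) ^ i * y i"
proof -
  \<comment> \<open>The alternating signs make consecutive initial segments telescope. As
    \<open>n\<close> is even and exactly one of \<open>i\<close>, \<open>Suc i\<close> is odd, the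
    total of \<open>y\<close> cancels and only the increment \<open>y i\<close> survives.\<close>
  have "(\<Sum>j<r. transitive_preimage n y j)
      = (if odd r then \<Sum>j<n. y j else 0) + (-1) ^ r * (\<Sum>j<r. y j)" for r
    by (induction r) (auto simp: transitive_preimage_def algebra_simps)
  with assms show ?thesis
    by (auto simp: sum_transitive_sign algebra_simps simp del: sum.lessThan_Suc)
      (auto simp: algebra_simps)
qed

text \<open>The bilinear form of \<open>transitive_mat n\<close>: conjugation by the signs
  \<open>(-1) ^ i\<close> turns the inverse matrix, for even \<open>n\<close>, back into the
  matrix.\<close>

definition skew_form :: "nat \<Rightarrow> (nat \<Rightarrow> int) \<Rightarrow> (nat \<Rightarrow> int) \<Rightarrow> int" where
  "skew_form n z y = (\<Sum>i<n. z i * ((\<Sum>j<n. y j) - (\<Sum>j<i. y j) - (\<Sum>j<Suc i. y j)))"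

lemma sum_preimage_eq_skew_form:
  "(\<Sum>i<n. (-1) ^ i * z i * transitive_preimage n y i) = skew_form n z y"
  unfolding skew_form_def transitive_preimage_def
proof (intro sum.cong refl)
  fix i
  have "(-1) ^ i * a * ((-1) ^ i * b) = a * b" for a b :: int
    by (cases "even i") auto
  then show "(-1) ^ i * z i * ((-1) ^ i * ((\<Sum>j<n. y j) - (\<Sum>j<i. y j) - (\<Sum>j<Suc i. y j)))
      = z i * ((\<Sum>j<n. y j) - (\<Sum>j<i. y j) - (\<Sum>j<Suc i. y j))" .
qed

lemma skew_form_swap: "skew_form n y z = - skew_form n z y"
proof -
  \<comment> \<open>The totals become free parameters \<open>Y\<close> and \<open>Z\<close>, so that
    they stay fixed in the induction on \<open>r\<close>. Inserting the true totals at
    \<open>r = n\<close> makes the right-hand side vanish.\<close>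
  have *: "(\<Sum>i<r. z i * (Y - (\<Sum>j<i. y j) - (\<Sum>j<Suc i. y j)))
      + (\<Sum>i<r. y i * (Z - (\<Sum>j<i. z j) - (\<Sum>j<Suc i. z j)))
      = Y * (\<Sum>i<r. z i) + Z * (\<Sum>i<r. y i) - 2 * (\<Sum>i<r. z i) * (\<Sum>i<r. y i)" for r Y Z
    by (induction r) (auto simp: algebra_simps)
  show ?thesis
    using *[where r = n and Y = "\<Sum>j<n. y j" and Z = "\<Sum>j<n. z j"]
    unfolding skew_form_def by (simp add: algebra_simps)
qed

lemma skew_form_self [simp]: "skew_form n y y = 0"
  using skew_form_swap[of n y y] by simp

lemma skew_form_one: "skew_form n y (\<lambda>_. 1) = (\<Sum>i<n. y i * (int n - 1 - 2 * int i))"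
  unfolding skew_form_def by (intro sum.cong) auto

section \<open>Which values the signed sums take\<close>

text \<open>Signs \<open>a\<close> and \<open>b\<close> on the outermost pair of weights,
  \<open>2 * h + 1\<close> and its negative, shift half the sum by \<open>2 * h + 1\<close> times
  -1, 0 or 1. If the target exceeds \<open>h ^ 2\<close> in absolute value, one such shift towards
  zero suffices, because \<open>(h + 1) ^ 2 - (2 * h + 1) = h ^ 2\<close>.\<close>

lemma signed_sum_odd_numbers:
  assumes "\<bar>m\<bar> \<le> (int h)\<^sup>2"
  shows "\<exists>y. (\<forall>i. y i \<in> {1, -1 :: int}) \<and>
    (\<Sum>i<2 * h. y i * (int (2 * h) - 1 - 2 * int i)) = 2 * m"
  using assms
proof (induction h arbitrary: m)
  case 0
  then show ?case by (intro exI[of _ "\<lambda>_. 1"]) auto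
next
  case (Suc h)
  have "\<exists>a b. a \<in> {1, -1} \<and> b \<in> {1, -1} \<and>
      \<bar>m - (a - b) div 2 * (2 * int h + 1)\<bar> \<le> (int h)\<^sup>2 \<and> even (a - b :: int)"
  proof -
    consider "\<bar>m\<bar> \<le> (int h)\<^sup>2" | "m > (int h)\<^sup>2" | "m < - (int h)\<^sup>2" by linarith
    then show ?thesis
    proof cases
      case 1
      then show ?thesis by (intro exI[of _ 1]) auto
    next
      case 2
      \<comment> \<open>This prevents overshooting: the shifted target is at least
        \<open>h ^ 2 - 2 * h\<close>, hence at least \<open>- (h ^ 2)\<close>.\<close>
      have "int h \<le> (int h)\<^sup>2" by (cases h) (auto simp: power2_eq_square)
      with 2 Suc.prems show ?thesis
        by (intro exI[of _ 1] exI[of _ "-1"]) (auto simp: power2_eq_square algebra_simps)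
    next
      case 3
      have "int h \<le> (int h)\<^sup>2" by (cases h) (auto simp: power2_eq_square)
      with 3 Suc.prems show ?thesis
        by (intro exI[of _ "-1"] exI[of _ 1]) (auto simp: power2_eq_square algebra_simps)
    qed
  qed
  then obtain a b where ab: "a \<in> {1, -1}" "b \<in> {1, -1}" "even (a - b)"
    and m: "\<bar>m - (a - b) div 2 * (2 * int h + 1)\<bar> \<le> (int h)\<^sup>2"
    by blast
  from Suc.IH[OF m] obtain y where y: "\<And>i. y i \<in> {1, -1 :: int}"
    and sum_y: "(\<Sum>i<2 * h. y i * (int (2 * h) - 1 - 2 * int i))
      = 2 * (m - (a - b) div 2 * (2 * int h + 1))"
    by blast
  \<comment> \<open>The old signs move up by one place, which keeps their weights when
    \<open>h\<close> grows to \<open>Suc h\<close>.\<close>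
  define y' where "y' i = (if i = 0 then a else if i = Suc (2 * h) then b else y (i - 1))" for i
  have "(\<Sum>i<2 * Suc h. y' i * (int (2 * Suc h) - 1 - 2 * int i))
      = (a - b) * (2 * int h + 1) + (\<Sum>i<2 * h. y' (Suc i) * (int (2 * h) - 1 - 2 * int i))"
  proof -
    have "(\<Sum>i<2 * Suc h. f i) = f 0 + (\<Sum>i<2 * h. f (Suc i)) + f (Suc (2 * h))"
      for f :: "nat \<Rightarrow> int"
      by (simp flip: sum.lessThan_Suc_shift)
    then show ?thesis
      by (simp only:) (simp add: y'_def algebra_simps)
  qed
  also have "(\<Sum>i<2 * h. y' (Suc i) * (int (2 * h) - 1 - 2 * int i))
      = (\<Sum>i<2 * h. y i * (int (2 * h) - 1 - 2 * int i))"
    by (intro sum.cong) (auto simp: y'_def)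
  also have "(a - b) * (2 * int h + 1) + \<dots> = 2 * m"
    unfolding sum_y using ab(3) by (auto elim!: evenE simp: algebra_simps)
  finally show ?case
    using y ab by (intro exI[of _ y']) (auto simp: y'_def)
qed

section \<open>The two additional vertices and the final choice of signs\<close>

definition extended_sign :: "nat \<Rightarrow> (nat \<Rightarrow> nat \<Rightarrow> int) \<Rightarrow> nat \<Rightarrow> nat \<Rightarrow> int" where
  "extended_sign n w i j =
    (if i < n \<and> n \<le> j then (-1) ^ i * w (j - n) i
     else if n \<le> i \<and> j < n then - ((-1) ^ j * w (i - n) j)
     else transitive_sign i j)"

text \<open>The Schur complement is \<open>transitive_mat 2\<close> plus the matrix of values of
  \<open>skew_form n\<close> on \<open>w 0\<close> and \<open>w 1\<close>. Skew-symmetry kills the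
  diagonal, leaving a 2-by-2 determinant that is a square.\<close>

lemma det_extended_sign:
  assumes "even n"
  shows "det (mat (n + 2) (n + 2) (\<lambda>(i, j). extended_sign n w i j))
    = (1 + skew_form n (w 0) (w 1))\<^sup>2"
proof -
  define X where "X = mat n 2 (\<lambda>(i, j). transitive_preimage n (w j) i)"
  define C where "C = mat 2 n (\<lambda>(i, j). - ((-1) ^ j * w i j))"
  have AX: "transitive_mat n * X = mat n 2 (\<lambda>(i, j). (-1) ^ i * w j i)"
    using transitive_sign_preimage[OF assms]
    by (intro eq_matI)
      (auto simp: X_def transitive_mat_def scalar_prod_def atLeast0LessThan)
  have CX: "C * X = mat 2 2 (\<lambda>(i, j). - skew_form n (w i) (w j))"
    by (intro eq_matI)
      (auto simp: X_def C_def scalar_prod_def atLeast0LessThan sum_negf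
        simp flip: sum_preimage_eq_skew_form)
  have "mat (n + 2) (n + 2) (\<lambda>(i, j). extended_sign n w i j)
      = four_block_mat (transitive_mat n) (transitive_mat n * X) C (transitive_mat 2)"
    unfolding AX by (intro eq_matI)
      (auto simp: extended_sign_def transitive_mat_def transitive_sign_def C_def)
  then have "det (mat (n + 2) (n + 2) (\<lambda>(i, j). extended_sign n w i j))
      = det (transitive_mat n) * det (transitive_mat 2 - C * X)"
    by (simp add: det_four_block_mat_schur[of _ n _ 2] C_def X_def)
  also have "transitive_mat 2 - C * X = mat 2 2 (\<lambda>(i, j). if i = j then 0
      else if i < j then 1 + skew_form n (w 0) (w 1) else - (1 + skew_form n (w 0) (w 1)))"
    unfolding CX using skew_form_swap[of n "w 1" "w 0"]
    by (intro eq_matI) (auto simp: transitive_mat_def transitive_sign_def less_2_cases_iff)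
  finally show ?thesis
    by (simp add: det_transitive_mat[OF assms] det_skew_2)
qed

theorem theorem3p2:
  fixes n k :: nat
  assumes "even n" and "n > 0"
    and "odd k" and "k > 0"
    and "real k < (real n)\<^sup>2 / 2 + 1"
  shows "\<exists>T. tournament (n + 2) T \<and> det (seidel_matrix (n + 2) T) = (int k)\<^sup>2"
proof -
  obtain h where n: "n = 2 * h" using assms(1) by (elim evenE)
  obtain m where k: "k = 2 * m + 1" using assms(3) by (elim oddE)
  have "real m < real (h\<^sup>2)"
    using assms(5) by (simp add: n k power2_eq_square)
  then have "m < h\<^sup>2" by (simp only: of_nat_less_iff)
  \<comment> \<open>The target is negative because \<open>skew_form_one\<close> has the constant
    vector as second argument, whereas the determinant has it first; swapping gives
    \<open>1 + 2 * m = k\<close>.\<close>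
  then have "\<bar>- int m\<bar> \<le> (int h)\<^sup>2" by (simp flip: of_nat_power)
  from signed_sum_odd_numbers[OF this] obtain y where y: "\<And>i. y i \<in> {1, -1 :: int}"
    and "skew_form n y (\<lambda>_. 1) = - 2 * int m"
    unfolding skew_form_one n by auto
  then have form: "skew_form n (\<lambda>_. 1) y = 2 * int m"
    using skew_form_swap[of n "\<lambda>_. 1" y] by simp
  define w where "w = (\<lambda>c. if c = (0 :: nat) then (\<lambda>_. 1) else y)"
  have "w c i \<in> {1, -1}" for c i
    using y by (auto simp: w_def)
  then have sign: "(-1) ^ i * w c i \<in> {1, -1}" for c i
    by (cases "even i") auto
  obtain T where "tournament (n + 2) T"
    and "seidel_matrix (n + 2) T = mat (n + 2) (n + 2) (\<lambda>(i, j). extended_sign n w i j)"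
  proof (rule tournament_of_skew_signs)
    show "extended_sign n w i j \<in> {1, -1}" if "i \<noteq> j" for i j
      using that sign[of i "j - n"] sign[of j "i - n"]
      by (auto simp: extended_sign_def transitive_sign_def)
    show "extended_sign n w j i = - extended_sign n w i j" for i j
      by (auto simp: extended_sign_def transitive_sign_def)
  qed
  moreover have "det (mat (n + 2) (n + 2) (\<lambda>(i, j). extended_sign n w i j)) = (int k)\<^sup>2"
    unfolding det_extended_sign[OF assms(1)] using form by (simp add: w_def k)
  ultimately show ?thesis by auto
qed

end
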